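(* (Generalized Policy Improvement) Let $M=(\mathcal{S},\mathcal{A},p,R,\gamma)$ be a Markov decision process with finite state space $\mathcal{S}$, finite action space $\mathcal{A}$ and discount factor $\gamma\in[0,1)$. Let $\pi_1,\pi_2,\dots,\pi_n$ be $n$ decision policies, with action-value functions $Q^{\pi_1},\dots,Q^{\pi_n}$ in $M$, and let $\tilde{Q}^{\pi_1},\tilde{Q}^{\pi_2},\dots,\tilde{Q}^{\pi_n}:\mathcal{S}\times\mathcal{A}\to\mathbb{R}$ be approximations of their respective action-value functions such that $$|Q^{\pi_i}(s,a)-\tilde{Q}^{\pi_i}(s,a)|\le\epsilon\quad\text{for all } s\in\mathcal{S},\ a\in\mathcal{A},\ \text{and } i\in\{1,2,\dots,n\}.$$ Let $\pi$ be a policy satisfying, for every $s\in\mathcal{S}$, $$\pi(s)\in\operatorname*{argmax}_{a}\max_{i}\tilde{Q}^{\pi_i}(s,a).$$ Then $$Q^{\pi}(s,a)\ge\max_i Q^{\pi_i}(s,a)-\frac{2}{1-\gamma}\,\epsilon$$ for any $s\in\mathcal{S}$ and $a\in\mathcal{A}$, where $Q^{\pi}$ is the action-value function of $\pi$ in $M$.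
   Context: A Markov decision process (MDP) is a tuple $M=(\mathcal{S},\mathcal{A},p,R,\gamma)$, where $\mathcal{S}$ and $\mathcal{A}$ are the (nonempty, finite) state and action spaces, $p(\cdot|s,a)$ is the distribution of the next state after taking action $a$ in state $s$, $R(s,a,s')$ is the random reward received at the transition $s\xrightarrow{a}s'$, with (finite) expected value $r(s,a,s')$, and $\gamma\in[0,1)$ is the discount factor. Write $r(s,a)=\mathbb{E}_{S'\sim p(\cdot|s,a)}[r(s,a,S')]$. A policy is a mapping $\pi:\mathcal{S}\to\mathcal{A}$. Its action-value function is $$Q^{\pi}(s,a)=\mathbb{E}^{\pi}\Big[\sum_{k=0}^{\infty}\gamma^{k}\,r(S_k,A_k)\,\Big|\,S_0=s,A_0=a\Big],$$ where $S_{k+1}\sim p(\cdot|S_k,A_k)$ and $A_{k}=\pi(S_{k})$ for $k\ge1$; that is, the expected discounted sum of rewards when taking action $a$ in state $s$ and following $\pi$ thereafter. Equivalently, $Q^\pi$ is the unique function with $Q^{\pi}(s,a)=r(s,a)+\gamma\sum_{s'}p(s'|s,a)\,Q^{\pi}(s',\pi(s'))$ for all $(s,a)$. *)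

theory Defs
  imports "HOL-Probability.Probability"
begin

text \<open>
  The state and action spaces are types, required to be of class \<open>finite\<close>.
  \<open>reward M s a s'\<close> is the distribution of the random reward on the transition from \<open>s\<close> to \<open>s'\<close>
  under \<open>a\<close>.
\<close>

record ('s, 'a) mdp =
  transition :: "'s \<Rightarrow> 'a \<Rightarrow> 's pmf"
  reward :: "'s \<Rightarrow> 'a \<Rightarrow> 's \<Rightarrow> real measure"
  discount :: real

definition markov_decision_process :: "('s::finite, 'a::finite) mdp \<Rightarrow> bool" where
  "markov_decision_process M \<longleftrightarrow>
    (\<forall>s a s'. real_distribution (reward M s a s') \<and> integrable (reward M s a s') (\<lambda>x. x)) \<and>
    0 \<le> discount M \<and> discount M < 1"

definition expected_reward :: "('s::finite, 'a::finite) mdp \<Rightarrow> 's \<Rightarrow> 'a \<Rightarrow> real" where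
  "expected_reward M s a =
    measure_pmf.expectation (transition M s a) (\<lambda>s'. \<integral>x. x \<partial>reward M s a s')"

text \<open>
  The conditional law of \<open>(S\<^sub>n, A\<^sub>n)\<close> given the history \<open>\<omega> k = (S\<^sub>k, A\<^sub>k)\<close>, \<open>k < n\<close>,
  for the process that starts in \<open>(s, a)\<close> and follows \<open>\<pi>\<close> from time 1 on.
\<close>

definition step_kernel ::
  "('s::finite, 'a::finite) mdp \<Rightarrow> ('s \<Rightarrow> 'a) \<Rightarrow> 's \<Rightarrow> 'a \<Rightarrow>
   nat \<Rightarrow> (nat \<Rightarrow> 's \<times> 'a) \<Rightarrow> ('s \<times> 'a) measure" where
  "step_kernel M \<pi> s a n \<omega> =
    (case n of
       0 \<Rightarrow> measure_pmf (return_pmf (s, a))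
     | Suc k \<Rightarrow>
         measure_pmf (map_pmf (\<lambda>s'. (s', \<pi> s')) (transition M (fst (\<omega> k)) (snd (\<omega> k)))))"

lemma Ionescu_Tulcea_step_kernel:
  fixes M :: "('s::finite, 'a::finite) mdp"
  shows "Ionescu_Tulcea (step_kernel M \<pi> s a) (\<lambda>_. count_space UNIV)"
proof (rule Ionescu_Tulcea.intro)
  let ?N = "\<lambda>_::nat. count_space (UNIV :: ('s \<times> 'a) set)"
  show "step_kernel M \<pi> s a i \<in> PiM {0..<i} ?N \<rightarrow>\<^sub>M subprob_algebra (?N i)" for i
  proof (cases i)
    case 0
    show ?thesis
      unfolding 0 step_kernel_def by (simp add: measure_pmf_in_subprob_algebra)
  next
    case (Suc k)
    have "(\<lambda>\<omega>. \<omega> k) \<in> PiM {0..<i} ?N \<rightarrow>\<^sub>M count_space UNIV"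
      by (rule measurable_component_singleton) (simp add: Suc)
    from measurable_compose[OF this, of
        "\<lambda>x. measure_pmf (map_pmf (\<lambda>s'. (s', \<pi> s')) (transition M (fst x) (snd x)))"]
    show ?thesis
      unfolding Suc step_kernel_def by (simp add: measure_pmf_in_subprob_algebra)
  qed
  show "prob_space (step_kernel M \<pi> s a i \<omega>)" for i and \<omega> :: "nat \<Rightarrow> 's \<times> 'a"
    by (cases i) (simp_all add: step_kernel_def measure_pmf.prob_space_axioms)
qed

text \<open>
  The law of the trajectory \<open>((S\<^sub>0, A\<^sub>0), (S\<^sub>1, A\<^sub>1), \<dots>)\<close>: the measure that the Ionescu Tulcea
  theorem gives for the kernels above.
\<close>

definition trajectory_measure ::
  "('s::finite, 'a::finite) mdp \<Rightarrow> ('s \<Rightarrow> 'a) \<Rightarrow> 's \<Rightarrow> 'a \<Rightarrow> (nat \<Rightarrow> 's \<times> 'a) measure" where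
  "trajectory_measure M \<pi> s a =
    projective_family.lim UNIV
      (Ionescu_Tulcea.CI (step_kernel M \<pi> s a) (\<lambda>_. count_space UNIV))
      (\<lambda>_. count_space UNIV)"

definition action_value :: "('s::finite, 'a::finite) mdp \<Rightarrow> ('s \<Rightarrow> 'a) \<Rightarrow> 's \<Rightarrow> 'a \<Rightarrow> real" where
  "action_value M \<pi> s a =
    (\<integral>\<omega>. (\<Sum>k. discount M ^ k * expected_reward M (fst (\<omega> k)) (snd (\<omega> k)))
      \<partial>trajectory_measure M \<pi> s a)"

end

theory Submission
  imports Defs
begin

text \<open>
  The marginals of the trajectory measure are the iterates of a Markov kernel on state-action
  pairs, which turns \<open>action_value\<close> into a discounted series and yields the Bellman equation.
  Let \<open>\<Delta>\<close> be the largest value of \<open>Q\<^sup>\<pi>\<^sup>i - Q\<^sup>\<pi>\<close> over all \<open>i\<close>, \<open>s\<close>, \<open>a\<close>. Since \<open>\<pi>\<close> is greedy for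
  the approximations, \<open>Q\<^sup>\<pi>\<^sup>i(s', \<pi>\<^sub>i s') \<le> max\<^sub>j Q\<^sup>\<pi>\<^sup>j(s', \<pi> s') + 2\<epsilon> \<le> Q\<^sup>\<pi>(s', \<pi> s') + \<Delta> + 2\<epsilon>\<close>, and the
  Bellman equations give \<open>\<Delta> \<le> \<gamma> (\<Delta> + 2\<epsilon>)\<close>.
\<close>

section \<open>Marginals of the trajectory measure\<close>

definition step_pmf ::
  "('s::finite, 'a::finite) mdp \<Rightarrow> ('s \<Rightarrow> 'a) \<Rightarrow> 's \<times> 'a \<Rightarrow> ('s \<times> 'a) pmf" where
  "step_pmf M \<pi> x = map_pmf (\<lambda>s'. (s', \<pi> s')) (transition M (fst x) (snd x))"

primrec marginal_pmf ::
  "('s::finite, 'a::finite) mdp \<Rightarrow> ('s \<Rightarrow> 'a) \<Rightarrow> 's \<times> 'a \<Rightarrow> nat \<Rightarrow> ('s \<times> 'a) pmf" where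
  "marginal_pmf M \<pi> x 0 = return_pmf x"
| "marginal_pmf M \<pi> x (Suc n) = bind_pmf (marginal_pmf M \<pi> x n) (step_pmf M \<pi>)"

text \<open>The recursion appends a step at the end, as the trajectory construction does, whereas
  the Bellman equation conditions on the first step. Associativity of bind converts one into the
  other.\<close>

lemma marginal_pmf_Suc_left:
  "marginal_pmf M \<pi> x (Suc n) = bind_pmf (step_pmf M \<pi> x) (\<lambda>y. marginal_pmf M \<pi> y n)"
  by (induction n) (simp_all add: bind_return_pmf bind_return_pmf' bind_assoc_pmf[symmetric])

text \<open>\<open>CI J\<close> is \<open>C\<close> up to the bound \<open>up_to J\<close>,
  restricted to \<open>J\<close>. On an initial segment that restriction is the identity, since the
  points of the product space are already extensional.\<close>

lemma (in Ionescu_Tulcea) CI_atLeast0LessThan: "CI {0..<n} = C 0 n (\<lambda>_. undefined)"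
proof -
  have "up_to {0..<n} = n"
    using up_to[of "{0..<n}"] by (intro antisym) (auto simp: up_to_iff)
  moreover have "distr (C 0 n (\<lambda>_. undefined)) (PiM {0..<n} M) (\<lambda>f. restrict f {0..<n}) =
      distr (C 0 n (\<lambda>_. undefined)) (C 0 n (\<lambda>_. undefined)) (\<lambda>f. f)"
    by (rule distr_cong) (auto simp: sets_C space_C space_PiM)
  ultimately show ?thesis
    unfolding CI_def by simp
qed

text \<open>Integrating out the newest coordinate leaves a function of the previous pair alone,
  because the kernel is Markov. The induction hypothesis is applied to that new function, so
  \<open>f\<close> must be arbitrary.\<close>

lemma nn_integral_C_step_kernel:
  fixes M :: "('s::finite, 'a::finite) mdp" and f :: "'s \<times> 'a \<Rightarrow> ennreal"
  shows "(\<integral>\<^sup>+\<omega>. f (\<omega> n)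
      \<partial>Ionescu_Tulcea.C (step_kernel M \<pi> s a) (\<lambda>_. count_space UNIV) 0 (Suc n) (\<lambda>_. undefined)) =
    (\<integral>\<^sup>+x. f x \<partial>marginal_pmf M \<pi> (s, a) n)"
proof -
  let ?N = "\<lambda>_::nat. count_space (UNIV :: ('s \<times> 'a) set)"
  let ?K = "step_kernel M \<pi> s a"
  interpret IT: Ionescu_Tulcea ?K ?N
    by (rule Ionescu_Tulcea_step_kernel)
  \<comment> \<open>The last stage of \<open>C\<close> is a bind with \<open>eP n\<close>, which
    writes a draw from the kernel into coordinate \<open>n\<close>.\<close>
  have last: "(\<integral>\<^sup>+\<omega>. f (\<omega> n) \<partial>IT.C 0 (Suc n) (\<lambda>_. undefined)) =
      (\<integral>\<^sup>+\<omega>. (\<integral>\<^sup>+x. f x \<partial>?K n \<omega>) \<partial>IT.C 0 n (\<lambda>_. undefined))"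
    for n and f :: "'s \<times> 'a \<Rightarrow> ennreal"
  proof -
    have f: "(\<lambda>\<omega>. f (\<omega> n)) \<in> borel_measurable (PiM {0..<Suc n} ?N)"
      by (rule measurable_compose[OF measurable_component_singleton]) auto
    have "(\<integral>\<^sup>+\<omega>. f (\<omega> n) \<partial>IT.C 0 (Suc n) (\<lambda>_. undefined)) =
        (\<integral>\<^sup>+\<omega>. (\<integral>\<^sup>+\<omega>'. f (\<omega>' n) \<partial>IT.eP n \<omega>) \<partial>IT.C 0 n (\<lambda>_. undefined))"
      using f IT.measurable_eP[of n]
      by (simp add: nn_integral_bind[where B = "PiM {0..<Suc n} ?N"]
          measurable_cong_sets[OF IT.sets_C refl])
    also have "\<dots> = (\<integral>\<^sup>+\<omega>. (\<integral>\<^sup>+x. f x \<partial>?K n \<omega>) \<partial>IT.C 0 n (\<lambda>_. undefined))"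
      using f by (intro nn_integral_cong) (simp add: IT.nn_integral_eP IT.space_C)
    finally show ?thesis .
  qed
  show ?thesis
  proof (induction n arbitrary: f)
    case 0
    show ?case
      unfolding last by (simp add: nn_integral_return step_kernel_def)
  next
    case (Suc n)
    have "(\<integral>\<^sup>+\<omega>. f (\<omega> (Suc n)) \<partial>IT.C 0 (Suc (Suc n)) (\<lambda>_. undefined)) =
        (\<integral>\<^sup>+\<omega>. (\<integral>\<^sup>+x. f x \<partial>step_pmf M \<pi> (\<omega> n)) \<partial>IT.C 0 (Suc n) (\<lambda>_. undefined))"
      unfolding last[of "Suc n"] by (simp only: step_kernel_def step_pmf_def nat.case)
    also have "\<dots> = (\<integral>\<^sup>+y. (\<integral>\<^sup>+x. f x \<partial>step_pmf M \<pi> y) \<partial>marginal_pmf M \<pi> (s, a) n)"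
      by (rule Suc.IH)
    finally show ?case
      by simp
  qed
qed

lemma sets_trajectory_measure:
  fixes M :: "('s::finite, 'a::finite) mdp"
  shows "sets (trajectory_measure M \<pi> s a) = sets (PiM UNIV (\<lambda>_. count_space UNIV))"
proof -
  interpret IT: Ionescu_Tulcea "step_kernel M \<pi> s a" "\<lambda>_. count_space UNIV"
    by (rule Ionescu_Tulcea_step_kernel)
  show ?thesis
    unfolding trajectory_measure_def by simp
qed

lemma measurable_component_trajectory_measure:
  "(\<lambda>\<omega>. \<omega> n) \<in> trajectory_measure M \<pi> s a \<rightarrow>\<^sub>M count_space UNIV"
  using measurable_component_singleton[of n UNIV "\<lambda>_. count_space UNIV"]
  by (simp add: measurable_cong_sets[OF sets_trajectory_measure refl])

text \<open>The projection to coordinate \<open>n\<close> factors through the restriction to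
  \<open>{0..<Suc n}\<close>, the shortest initial segment containing \<open>n\<close>. There the
  projective limit property identifies the law as \<open>C 0 (Suc n)\<close>.\<close>

lemma distr_trajectory_measure:
  fixes M :: "('s::finite, 'a::finite) mdp"
  shows "distr (trajectory_measure M \<pi> s a) (count_space UNIV) (\<lambda>\<omega>. \<omega> n) =
    measure_pmf (marginal_pmf M \<pi> (s, a) n)"
proof (rule measure_eqI)
  fix A :: "('s \<times> 'a) set"
  let ?N = "\<lambda>_::nat. count_space (UNIV :: ('s \<times> 'a) set)"
  let ?T = "trajectory_measure M \<pi> s a"
  interpret IT: Ionescu_Tulcea "step_kernel M \<pi> s a" ?N
    by (rule Ionescu_Tulcea_step_kernel)
  have meas: "(\<lambda>\<omega>. restrict \<omega> {0..<Suc n}) \<in> ?T \<rightarrow>\<^sub>M PiM {0..<Suc n} ?N"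
    by (simp add: measurable_cong_sets[OF sets_trajectory_measure refl] measurable_restrict_subset)
  have comp: "(\<lambda>\<omega>. \<omega> n) \<in> PiM {0..<Suc n} ?N \<rightarrow>\<^sub>M count_space UNIV"
    by (rule measurable_component_singleton) simp
  have "distr ?T (PiM {0..<Suc n} ?N) (\<lambda>\<omega>. restrict \<omega> {0..<Suc n}) =
      IT.C 0 (Suc n) (\<lambda>_. undefined)"
    using IT.distr_lim[of "{0..<Suc n}"]
    unfolding trajectory_measure_def IT.CI_atLeast0LessThan by simp
  then have "distr ?T (count_space UNIV) (\<lambda>\<omega>. \<omega> n) =
      distr (IT.C 0 (Suc n) (\<lambda>_. undefined)) (count_space UNIV) (\<lambda>\<omega>. \<omega> n)"
    using distr_distr[OF comp meas] by (simp add: comp_def)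
  moreover have "emeasure (distr (IT.C 0 (Suc n) (\<lambda>_. undefined)) (count_space UNIV) (\<lambda>\<omega>. \<omega> n)) A =
      emeasure (measure_pmf (marginal_pmf M \<pi> (s, a) n)) A"
  proof -
    have "(\<lambda>\<omega>. \<omega> n) \<in> IT.C 0 (Suc n) (\<lambda>_. undefined) \<rightarrow>\<^sub>M count_space UNIV"
      using comp by (simp del: IT.C.simps add: measurable_cong_sets[OF IT.sets_C refl])
    then have "emeasure (distr (IT.C 0 (Suc n) (\<lambda>_. undefined)) (count_space UNIV) (\<lambda>\<omega>. \<omega> n)) A =
        (\<integral>\<^sup>+\<omega>. indicator A (\<omega> n) \<partial>IT.C 0 (Suc n) (\<lambda>_. undefined))"
      by (simp del: IT.C.simps nn_integral_indicator
          add: nn_integral_indicator[symmetric] nn_integral_distr)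
    then show ?thesis
      unfolding nn_integral_C_step_kernel by simp
  qed
  ultimately show "emeasure (distr ?T (count_space UNIV) (\<lambda>\<omega>. \<omega> n)) A =
      emeasure (measure_pmf (marginal_pmf M \<pi> (s, a) n)) A"
    by simp
qed simp

lemma integral_trajectory_measure_component:
  fixes f :: "'s::finite \<times> 'a::finite \<Rightarrow> real"
  shows "(\<integral>\<omega>. f (\<omega> n) \<partial>trajectory_measure M \<pi> s a) =
    measure_pmf.expectation (marginal_pmf M \<pi> (s, a) n) f"
  using integral_distr[OF measurable_component_trajectory_measure[of n M \<pi> s a], of f]
  by (simp add: distr_trajectory_measure)

lemma integrable_trajectory_measure_component:
  fixes f :: "'s::finite \<times> 'a::finite \<Rightarrow> real"
  shows "integrable (trajectory_measure M \<pi> s a) (\<lambda>\<omega>. f (\<omega> n))"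
  using integrable_distr_eq[OF measurable_component_trajectory_measure[of n M \<pi> s a], of f]
  by (simp add: distr_trajectory_measure integrable_measure_pmf_finite)

section \<open>Discounted series, the Bellman equation and the improvement bound\<close>

lemma abs_expectation_le:
  fixes f :: "'b::finite \<Rightarrow> real"
  assumes "\<And>x. \<bar>f x\<bar> \<le> B"
  shows "\<bar>measure_pmf.expectation p f\<bar> \<le> B"
proof -
  have "\<bar>measure_pmf.expectation p f\<bar> \<le> measure_pmf.expectation p (\<lambda>x. \<bar>f x\<bar>)"
    by (rule integral_abs_bound)
  also have "\<dots> \<le> measure_pmf.expectation p (\<lambda>_. B)"
    by (rule integral_mono) (simp_all add: integrable_measure_pmf_finite assms)
  finally show ?thesis
    by simp
qed

context
  fixes M :: "('s::finite, 'a::finite) mdp" and r :: "'s \<times> 'a \<Rightarrow> real"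
  assumes M: "markov_decision_process M"
  defines "r \<equiv> \<lambda>x. expected_reward M (fst x) (snd x)"
begin

lemma discount_nonneg: "0 \<le> discount M" and discount_less_1: "discount M < 1"
  using M by (auto simp: markov_decision_process_def)

lemma summable_discounted:
  fixes f :: "nat \<Rightarrow> real"
  assumes "\<And>k. \<bar>f k\<bar> \<le> B"
  shows "summable (\<lambda>k. discount M ^ k * f k)"
proof (rule summable_comparison_test')
  show "summable (\<lambda>k. discount M ^ k * B)"
    using discount_nonneg discount_less_1 by (intro summable_mult2 summable_geometric) simp
  show "norm (discount M ^ k * f k) \<le> discount M ^ k * B" if "k \<ge> 0" for k
    using discount_nonneg assms[of k] by (simp add: abs_mult mult_left_mono)
qed

lemma abs_reward_le: "\<bar>r x\<bar> \<le> (MAX y. \<bar>r y\<bar>)"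
  by (rule Max_ge) auto

lemma summable_discounted_expectation:
  "summable (\<lambda>k. discount M ^ k * measure_pmf.expectation (p k) r)"
  by (rule summable_discounted) (rule abs_expectation_le[OF abs_reward_le])

text \<open>Sum and integral may be exchanged: there are finitely many state-action pairs, so
  rewards are bounded and a geometric series dominates both the pointwise series and the series of
  integrals.\<close>

lemma action_value_eq_suminf:
  "action_value M \<pi> s a =
    (\<Sum>k. discount M ^ k * measure_pmf.expectation (marginal_pmf M \<pi> (s, a) k) r)"
proof -
  let ?T = "trajectory_measure M \<pi> s a"
  have abs_term: "\<bar>discount M ^ k * r x\<bar> = discount M ^ k * \<bar>r x\<bar>" for k x
    using discount_nonneg by (simp add: abs_mult)
  have "(\<integral>\<omega>. (\<Sum>k. discount M ^ k * r (\<omega> k)) \<partial>?T) = (\<Sum>k. \<integral>\<omega>. discount M ^ k * r (\<omega> k) \<partial>?T)"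
  proof (rule integral_suminf)
    show "integrable ?T (\<lambda>\<omega>. discount M ^ k * r (\<omega> k))" for k
      using integrable_trajectory_measure_component[of _ _ _ _ "\<lambda>x. discount M ^ k * r x"] .
    show "AE \<omega> in ?T. summable (\<lambda>k. norm (discount M ^ k * r (\<omega> k)))"
      unfolding real_norm_def abs_term
      by (intro AE_I2 summable_discounted[of _ "MAX y. \<bar>r y\<bar>"]) (simp add: abs_reward_le)
    have "(\<integral>\<omega>. norm (discount M ^ k * r (\<omega> k)) \<partial>?T) =
        discount M ^ k * measure_pmf.expectation (marginal_pmf M \<pi> (s, a) k) (\<lambda>x. \<bar>r x\<bar>)" for k
      unfolding real_norm_def abs_term
      using integral_trajectory_measure_component[where f = "\<lambda>x. \<bar>r x\<bar>"] by simp
    then show "summable (\<lambda>k. \<integral>\<omega>. norm (discount M ^ k * r (\<omega> k)) \<partial>?T)"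
      by (simp only:)
        (intro summable_discounted[of _ "MAX y. \<bar>r y\<bar>"] abs_expectation_le, simp add: abs_reward_le)
  qed
  then show ?thesis
    unfolding action_value_def
    by (simp add: r_def integral_trajectory_measure_component[where f = r, unfolded r_def])
qed

text \<open>The term \<open>k = 0\<close> of the series is the immediate reward. In every later term
  the first step is split off, and what remains is the series for the successor pair.\<close>

lemma Bellman_equation:
  "action_value M \<pi> s a = expected_reward M s a +
    discount M * measure_pmf.expectation (transition M s a) (\<lambda>s'. action_value M \<pi> s' (\<pi> s'))"
proof -
  let ?E = "\<lambda>x k. measure_pmf.expectation (marginal_pmf M \<pi> x k) r"
  let ?p = "step_pmf M \<pi> (s, a)"
  have summ: "summable (\<lambda>k. discount M ^ k * ?E x k)" for x
    by (rule summable_discounted_expectation)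
  \<comment> \<open>Written as a finite sum, the expectation over the first step commutes with the
    series in \<open>k\<close>.\<close>
  have E_Suc: "?E (s, a) (Suc k) = (\<Sum>y\<in>UNIV. pmf ?p y * ?E y k)" for k
    unfolding marginal_pmf_Suc_left by (subst pmf_expectation_bind[of UNIV]) auto
  have "(\<Sum>k. discount M ^ Suc k * ?E (s, a) (Suc k)) =
      (\<Sum>k. \<Sum>y\<in>UNIV. discount M * pmf ?p y * (discount M ^ k * ?E y k))"
    unfolding E_Suc by (simp add: sum_distrib_left mult_ac)
  also have "\<dots> = (\<Sum>y\<in>UNIV. \<Sum>k. discount M * pmf ?p y * (discount M ^ k * ?E y k))"
    by (rule suminf_sum) (intro summable_mult summ)
  also have "\<dots> = (\<Sum>y\<in>UNIV. discount M * pmf ?p y * action_value M \<pi> (fst y) (snd y))"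
    by (simp add: suminf_mult[OF summ] action_value_eq_suminf)
  also have "\<dots> = discount M *
      measure_pmf.expectation ?p (\<lambda>y. action_value M \<pi> (fst y) (snd y))"
    by (subst integral_measure_pmf_real[of UNIV]) (auto simp: sum_distrib_left mult_ac)
  also have "measure_pmf.expectation ?p (\<lambda>y. action_value M \<pi> (fst y) (snd y)) =
      measure_pmf.expectation (transition M s a) (\<lambda>s'. action_value M \<pi> s' (\<pi> s'))"
    by (simp add: step_pmf_def)
  finally show ?thesis
    using suminf_split_head[OF summ[of "(s, a)"]]
    by (simp add: action_value_eq_suminf r_def del: marginal_pmf.simps(2))
qed

text \<open>The approximations enter only through the slack \<open>\<delta>\<close>, which becomes
  \<open>2 * \<epsilon>\<close> in the application. Finiteness of \<open>I\<close> and of the two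
  types lets the largest gap \<open>\<Delta>\<close> be attained.\<close>

lemma generalized_policy_improvement:
  fixes \<pi>s :: "'i \<Rightarrow> 's \<Rightarrow> 'a"
  assumes I: "finite I" "I \<noteq> {}"
    and \<pi>: "\<And>i s a. i \<in> I \<Longrightarrow> \<exists>j\<in>I. action_value M (\<pi>s i) s a \<le> action_value M (\<pi>s j) s (\<pi> s) + \<delta>"
    and i: "i \<in> I"
  shows "action_value M (\<pi>s i) s a - action_value M \<pi> s a \<le> discount M * \<delta> / (1 - discount M)"
proof -
  define D where "D = (\<lambda>(i, s, a). action_value M (\<pi>s i) s a - action_value M \<pi> s a)"
  define \<Delta> where "\<Delta> = Max (D ` (I \<times> UNIV))"
  have fin: "finite (D ` (I \<times> UNIV))"
    using I by simp
  have D_le: "action_value M (\<pi>s i) s a \<le> action_value M \<pi> s a + \<Delta>" if "i \<in> I" for i s a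
  proof -
    have "D (i, s, a) \<le> \<Delta>"
      unfolding \<Delta>_def using that by (intro Max_ge fin) auto
    then show ?thesis
      by (simp add: D_def)
  qed
  have "\<Delta> \<in> D ` (I \<times> UNIV)"
    unfolding \<Delta>_def using I by (intro Max_in fin) auto
  then obtain j t b where j: "j \<in> I"
    and \<Delta>: "\<Delta> = action_value M (\<pi>s j) t b - action_value M \<pi> t b"
    by (auto simp: D_def)
  \<comment> \<open>The hypothesis on \<pi> may switch to another index of \<open>I\<close>;
    \<open>D_le\<close> covers every index, so the switch is harmless.\<close>
  have "action_value M (\<pi>s j) s' (\<pi>s j s') \<le> action_value M \<pi> s' (\<pi> s') + (\<Delta> + \<delta>)" for s'
    using \<pi>[OF j, of s' "\<pi>s j s'"] D_le[of _ s' "\<pi> s'"] by fastforce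
  then have "measure_pmf.expectation (transition M t b) (\<lambda>s'. action_value M (\<pi>s j) s' (\<pi>s j s')) \<le>
      measure_pmf.expectation (transition M t b) (\<lambda>s'. action_value M \<pi> s' (\<pi> s') + (\<Delta> + \<delta>))"
    by (intro integral_mono) (simp_all add: integrable_measure_pmf_finite)
  also have "\<dots> = measure_pmf.expectation (transition M t b) (\<lambda>s'. action_value M \<pi> s' (\<pi> s')) + (\<Delta> + \<delta>)"
    by (simp add: integrable_measure_pmf_finite)
  \<comment> \<open>Both Bellman equations are taken at the maximizing pair \<open>(t, b)\<close>,
    so the immediate rewards cancel in the difference.\<close>
  finally have "\<Delta> \<le> discount M * (\<Delta> + \<delta>)"
    using mult_left_mono[OF _ discount_nonneg]
    unfolding \<Delta> Bellman_equation[of "\<pi>s j" t b] Bellman_equation[of \<pi> t b]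
    by (fastforce simp: algebra_simps)
  then have "\<Delta> \<le> discount M * \<delta> / (1 - discount M)"
    using discount_less_1 by (simp add: pos_le_divide_eq algebra_simps)
  with D_le[OF i, of s a] show ?thesis
    by simp
qed

end

theorem theorem1:
  fixes M :: "('s::finite, 'a::finite) mdp"
    and n :: nat
    and \<pi>s :: "nat \<Rightarrow> 's \<Rightarrow> 'a"
    and Q_approx :: "nat \<Rightarrow> 's \<Rightarrow> 'a \<Rightarrow> real"
    and \<epsilon> :: real
    and \<pi> :: "'s \<Rightarrow> 'a"
  assumes "markov_decision_process M"
    and "1 \<le> n"
    and "\<forall>i\<in>{1..n}. \<forall>s a. \<bar>action_value M (\<pi>s i) s a - Q_approx i s a\<bar> \<le> \<epsilon>"
    and "\<forall>s. is_arg_max (\<lambda>a. MAX i\<in>{1..n}. Q_approx i s a) (\<lambda>a. a \<in> UNIV) (\<pi> s)"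
  shows "\<forall>s a. action_value M \<pi> s a
           \<ge> (MAX i\<in>{1..n}. action_value M (\<pi>s i) s a) - 2 / (1 - discount M) * \<epsilon>"
proof (intro allI)
  fix s a
  let ?Q = "\<lambda>i. action_value M (\<pi>s i)"
  have approx: "\<bar>?Q i s a - Q_approx i s a\<bar> \<le> \<epsilon>" if "i \<in> {1..n}" for i s a
    using assms(3) that by blast
  \<comment> \<open>The witness \<open>j\<close> attains the approximate maximum at
    \<open>\<pi> s\<close>. The error \<epsilon> is paid twice: passing from \<open>?Q i\<close> to
    its approximation, and back from that of \<open>?Q j\<close>.\<close>
  have greedy: "\<exists>j\<in>{1..n}. ?Q i s a \<le> ?Q j s (\<pi> s) + 2 * \<epsilon>" if i: "i \<in> {1..n}" for i s a
  proof -
    have "(MAX j\<in>{1..n}. Q_approx j s (\<pi> s)) \<in> (\<lambda>j. Q_approx j s (\<pi> s)) ` {1..n}"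
      using assms(2) by (intro Max_in) auto
    then obtain j where j: "j \<in> {1..n}" "(MAX j\<in>{1..n}. Q_approx j s (\<pi> s)) = Q_approx j s (\<pi> s)"
      by blast
    have "Q_approx i s a \<le> (MAX j\<in>{1..n}. Q_approx j s a)"
      using i by (intro Max_ge) auto
    also have "\<dots> \<le> Q_approx j s (\<pi> s)"
      using assms(4) unfolding is_arg_max_def j(2)[symmetric] by (auto simp: not_less)
    finally show ?thesis
      using approx[OF i, of s a] approx[OF j(1), of s "\<pi> s"] j(1) by (intro bexI[of _ j]) linarith+
  qed
  \<comment> \<open>Index 1 exists because \<open>1 \<le> n\<close>. The sign of \<epsilon> allows
    the factor \<open>discount M\<close> in the numerator to be bounded by 1 next.\<close>
  have "0 \<le> \<epsilon>"
    using approx[of 1 s a] assms(2) by fastforce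
  have "discount M * (2 * \<epsilon>) / (1 - discount M) \<le> 2 / (1 - discount M) * \<epsilon>"
    using discount_less_1[OF assms(1)] \<open>0 \<le> \<epsilon>\<close>
    by (simp add: divide_right_mono mult_left_le_one_le discount_nonneg[OF assms(1)])
  then have "?Q i s a \<le> action_value M \<pi> s a + 2 / (1 - discount M) * \<epsilon>" if "i \<in> {1..n}" for i
    using generalized_policy_improvement[where I = "{1..n}" and \<pi>s = \<pi>s, OF assms(1) _ _ greedy that, of s a] that
    by fastforce
  then have "(MAX i\<in>{1..n}. ?Q i s a) \<le> action_value M \<pi> s a + 2 / (1 - discount M) * \<epsilon>"
    using assms(2) by (subst Max_le_iff) auto
  then show "action_value M \<pi> s a \<ge> (MAX i\<in>{1..n}. ?Q i s a) - 2 / (1 - discount M) * \<epsilon>"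
    by simp
qed

end
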